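(* Let $\epsilon \in (0,\tfrac13)$ with $1/\epsilon$ an integer. For every instance of the economic warehouse lot scheduling problem there exists a capacity-feasible cyclic policy $\tilde{\mathcal{P}}$, with some cycle length $\tau_{\mathrm{cycle}}$, such that: (1) $C(\tilde{\mathcal{P}}) \le (1+3\epsilon)\cdot \mathrm{OPT}$; (2) $\tau_{\mathrm{cycle}} \in \Big[ \dfrac{K_{\max}}{2\epsilon n \mathcal{M}}, \dfrac{2n\mathcal{M}}{\epsilon^2 H_{\min}} \Big]$; (3) for every commodity $i\in[n]$, $N(\tilde{\mathcal{P}}_i,[0,\tau_{\mathrm{cycle}})) \in \Big[\dfrac1\epsilon, \dfrac{4n^2\mathcal{M}^2}{\epsilon^2 K_{\min} H_{\min}}\Big]$, and $N(\tilde{\mathcal{P}}_i,[0,\tau_{\mathrm{cycle}})) = \frac1\epsilon$ for at least one commodity $i$.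
   Context: Economic warehouse lot scheduling problem. There are $n$ commodities; commodity $i \in [n]$ has unit demand rate, fixed ordering cost $K_i>0$, holding cost parameter $H_i>0$ (holding cost $2H_i$ per unit of inventory per unit time), and space requirement $\gamma_i>0$ per unit; the warehouse capacity is $\mathcal{V}>0$. A policy $\mathcal{P}_i$ for commodity $i$ is a sequence of ordering times $0=\tau_0<\tau_1<\cdots$ with $\tau_k\to\infty$ and real quantities $q_0,q_1,\dots$; its inventory level is $I(\mathcal{P}_i,t)=\sum_{k:\tau_k\le t} q_k - t$, required to be $\ge 0$ for all $t$. $N(\mathcal{P}_i,[a,b))$ is the number of orders placed in $[a,b)$. The cost over $[0,t)$ is $C(\mathcal{P}_i,[0,t)) = K_i N(\mathcal{P}_i,[0,t)) + 2H_i\int_0^t I(\mathcal{P}_i,s)\,ds$, the long-run average cost is $C_i(\mathcal{P}_i)=\limsup_{t\to\infty} C(\mathcal{P}_i,[0,t))/t$, and for $\mathcal{P}=(\mathcal{P}_1,\dots,\mathcal{P}_n)$, $C(\mathcal{P})=\sum_i C_i(\mathcal{P}_i)$ and $V_{\max}(\mathcal{P})=\sup_{t\ge0}\sum_i\gamma_i I(\mathcal{P}_i,t)$. $\mathcal{P}$ is capacity-feasible if $V_{\max}(\mathcal{P})\le\mathcal{V}$; $\mathrm{OPT}$ is the minimum of $C(\mathcal{P})$ over capacity-feasible policies. A cyclic policy with cycle length $\tau_{\mathrm{cycle}}$ repeats the same actions on every interval $[k\tau_{\mathrm{cycle}},(k+1)\tau_{\mathrm{cycle}})$. Notation: $K_{\max}=\max_i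 K_i$, $K_{\min}=\min_i K_i$, $H_{\min}=\min_i H_i$, $T_i^{\mathcal{V}}=\min\{\sqrt{K_i/H_i},\mathcal{V}/\gamma_i\}$, and $\mathcal{M}=\sum_{i\in[n]}\big(K_i/T_i^{\mathcal{V}} + H_i T_i^{\mathcal{V}}\big)$. *)

theory Defs
  imports "HOL-Analysis.Analysis"
begin

text \<open>Commodities are indexed by \<open>1, \<dots>, num_comm W\<close>; values of the
  parameter functions at other indices are irrelevant. The holding cost of commodity \<open>i\<close>
  per unit of inventory and unit of time is \<open>2 * hold_cost W i\<close>.\<close>

record warehouse =
  num_comm   :: nat
  order_cost :: "nat \<Rightarrow> real"
  hold_cost  :: "nat \<Rightarrow> real"
  space_req  :: "nat \<Rightarrow> real"
  capacity   :: real

definition commodities :: "warehouse \<Rightarrow> nat set" where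
  "commodities W = {1..num_comm W}"

definition valid_warehouse :: "warehouse \<Rightarrow> bool" where
  "valid_warehouse W \<longleftrightarrow>
     num_comm W \<ge> 1 \<and> capacity W > 0 \<and>
     (\<forall>i\<in>commodities W. order_cost W i > 0 \<and> hold_cost W i > 0 \<and> space_req W i > 0)"

definition K_max :: "warehouse \<Rightarrow> real" where
  "K_max W = Max (order_cost W ` commodities W)"

definition K_min :: "warehouse \<Rightarrow> real" where
  "K_min W = Min (order_cost W ` commodities W)"

definition H_min :: "warehouse \<Rightarrow> real" where
  "H_min W = Min (hold_cost W ` commodities W)"

definition T_cap :: "warehouse \<Rightarrow> nat \<Rightarrow> real" where
  "T_cap W i = min (sqrt (order_cost W i / hold_cost W i)) (capacity W / space_req W i)"

definition M_bound :: "warehouse \<Rightarrow> real" where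
  "M_bound W = (\<Sum>i\<in>commodities W. order_cost W i / T_cap W i + hold_cost W i * T_cap W i)"

record policy =
  order_time :: "nat \<Rightarrow> real"
  order_qty  :: "nat \<Rightarrow> real"

definition inventory :: "policy \<Rightarrow> real \<Rightarrow> real" where
  "inventory p t = (\<Sum>k | order_time p k \<le> t. order_qty p k) - t"

text \<open>Divergence of the ordering times makes the index sets in \<open>inventory\<close> and
  \<open>num_orders\<close> (on bounded intervals) finite. Quantities may be arbitrary reals.\<close>

definition valid_policy :: "policy \<Rightarrow> bool" where
  "valid_policy p \<longleftrightarrow>
     order_time p 0 = 0 \<and> strict_mono (order_time p) \<and>
     filterlim (order_time p) at_top sequentially \<and>
     (\<forall>t\<ge>0. inventory p t \<ge> 0)"

definition num_orders :: "policy \<Rightarrow> real set \<Rightarrow> nat" where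
  "num_orders p A = card {k. order_time p k \<in> A}"

definition cost_upto :: "warehouse \<Rightarrow> nat \<Rightarrow> policy \<Rightarrow> real \<Rightarrow> real" where
  "cost_upto W i p t =
     order_cost W i * real (num_orders p {0..<t}) +
     2 * hold_cost W i * integral {0..t} (inventory p)"

text \<open>The limit superior may be infinite, hence the extended reals.\<close>

definition avg_cost :: "warehouse \<Rightarrow> nat \<Rightarrow> policy \<Rightarrow> ereal" where
  "avg_cost W i p = Limsup at_top (\<lambda>t::real. ereal (cost_upto W i p t / t))"

definition order_at :: "policy \<Rightarrow> real \<Rightarrow> real \<Rightarrow> bool" where
  "order_at p t x \<longleftrightarrow> (\<exists>k. order_time p k = t \<and> order_qty p k = x)"

definition total_cost :: "warehouse \<Rightarrow> (nat \<Rightarrow> policy) \<Rightarrow> ereal" where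
  "total_cost W P = (\<Sum>i\<in>commodities W. avg_cost W i (P i))"

definition V_max :: "warehouse \<Rightarrow> (nat \<Rightarrow> policy) \<Rightarrow> ereal" where
  "V_max W P =
     (SUP t\<in>{0..}. ereal (\<Sum>i\<in>commodities W. space_req W i * inventory (P i) t))"

definition capacity_feasible :: "warehouse \<Rightarrow> (nat \<Rightarrow> policy) \<Rightarrow> bool" where
  "capacity_feasible W P \<longleftrightarrow>
     (\<forall>i\<in>commodities W. valid_policy (P i)) \<and> V_max W P \<le> ereal (capacity W)"

text \<open>The optimal value, as an infimum: no attainment is presupposed.\<close>

definition OPT :: "warehouse \<Rightarrow> ereal" where
  "OPT W = (INF P\<in>{P. capacity_feasible W P}. total_cost W P)"

text \<open>On every interval \<open>[k * \<tau>, (k + 1) * \<tau>)\<close> exactly the orders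
  of \<open>[0, \<tau>)\<close> are repeated, at the same offsets and with the same quantities. The
  cycle length is common to all commodities.\<close>

definition cyclic_policy :: "warehouse \<Rightarrow> real \<Rightarrow> (nat \<Rightarrow> policy) \<Rightarrow> bool" where
  "cyclic_policy W \<tau> P \<longleftrightarrow>
     \<tau> > 0 \<and>
     (\<forall>i\<in>commodities W. \<forall>k::nat. \<forall>s\<in>{0..<\<tau>}. \<forall>x.
        order_at (P i) (real k * \<tau> + s) x \<longleftrightarrow> order_at (P i) s x)"

end

theory Submission
  imports Defs
begin

text \<open>Cut a nearly optimal policy into consecutive windows, each of which ends when the slowest
  commodity has placed its \<open>1 / \<epsilon>\<close>-th order. Repeat one window forever: order up to the
  inventory level at its start, keep the orders in its interior, and truncate quantities so that
  the cumulative quantity never exceeds the cycle length. This lowers the inventory pointwise, hence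
  preserves feasibility, and costs at most one extra order per \<open>1 / \<epsilon>\<close> orders; by averaging, some
  window yields a cyclic policy within a factor of about \<open>1 + \<epsilon>\<close> of the optimum. The cycle length
  and the numbers of orders are then controlled by bounding the ordering and holding costs by
  \<open>2 * OPT\<close>, and \<open>OPT\<close> by the cost of ordering each commodity at equal intervals
  \<open>T_cap / n\<close>. A positive lower bound on \<open>OPT\<close> is needed since \<open>OPT\<close> need not be attained.\<close>

section \<open>Shifted integrals, increasing sequences and division into periods\<close>

lemma has_integral_shift_real:
  fixes f :: "real \<Rightarrow> real"
  assumes "(f has_integral i) {a + c..b + c}"
  shows "((\<lambda>x. f (x + c)) has_integral i) {a..b}"
  using has_integral_affinity'[of f i "a + c" "b + c" 1 c] assms
  by simp

lemma step_in_divergent_seq: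
  fixes f :: "nat \<Rightarrow> real"
  assumes "filterlim f at_top sequentially" and "f 0 \<le> t"
  obtains k where "f k \<le> t" "t < f (Suc k)"
proof -
  have "eventually (\<lambda>n. f n > t) sequentially"
    using assms(1) by (simp add: filterlim_at_top_dense)
  then obtain n where n: "f n > t"
    by (auto simp: eventually_sequentially)
  define l where "l = (LEAST n. f n > t)"
  have l: "f l > t" unfolding l_def by (rule LeastI[of _ n]) (rule n)
  have "l \<noteq> 0" using l assms(2) by (intro notI) simp
  then obtain k where k: "l = Suc k" using not0_implies_Suc by blast
  have "\<not> f k > t" using k unfolding l_def by (metis lessI not_less_Least)
  then show ?thesis using that[of k] l k by simp
qed

lemma strict_mono_step_index_iff:
  fixes f :: "nat \<Rightarrow> real"
  assumes "strict_mono f" "f k \<le> t" "t < f (Suc k)"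
  shows "f j \<le> t \<longleftrightarrow> j \<le> k"
proof
  assume "f j \<le> t"
  then have "f j < f (Suc k)" using assms by simp
  then show "j \<le> k" using assms(1) by (simp add: strict_mono_less)
next
  assume "j \<le> k"
  then have "f j \<le> f k" using assms(1) by (simp add: strict_mono_less_eq)
  then show "f j \<le> t" using assms by simp
qed

lemma increasing_steps_imp_mono:
  fixes x :: "nat \<Rightarrow> real"
  assumes "\<And>r. r < N \<Longrightarrow> x r < x (Suc r)" "r \<le> s" "s \<le> N"
  shows "x r \<le> x s"
  using assms(2,3)
proof (induction s rule: dec_induct)
  case (step n)
  then show ?case using assms(1)[of n] by simp
qed simp

lemma period_decomp:
  fixes t \<tau> :: real
  assumes "0 < \<tau>" "0 \<le> t"
  obtains j :: nat and s where "t = real j * \<tau> + s" "s \<in> {0..<\<tau>}"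
proof
  define j where "j = nat \<lfloor>t / \<tau>\<rfloor>"
  have "0 \<le> t / \<tau>" using assms by simp
  then have "real j \<le> t / \<tau>" "t / \<tau> < real j + 1"
    unfolding j_def by linarith+
  then show "t - real j * \<tau> \<in> {0..<\<tau>}"
    using assms by (simp add: field_simps)
  show "t = real j * \<tau> + (t - real j * \<tau>)" by simp
qed

section \<open>Inventory and cost of a valid policy\<close>

lemma inventory_between_orders:
  assumes "strict_mono (order_time p)" "order_time p k \<le> t" "t < order_time p (Suc k)"
  shows "inventory p t = (\<Sum>j\<le>k. order_qty p j) - t"
proof -
  have "{j. order_time p j \<le> t} = {..k}"
    using strict_mono_step_index_iff[OF assms] by auto
  then show ?thesis by (simp add: inventory_def)
qed

lemma finite_orders_upto:
  assumes "valid_policy p"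
  shows "finite {k. order_time p k \<le> t}"
proof (cases "0 \<le> t")
  case True
  then obtain k where "order_time p k \<le> t" "t < order_time p (Suc k)"
    using assms step_in_divergent_seq[of "order_time p" t] by (auto simp: valid_policy_def)
  then have "{j. order_time p j \<le> t} = {..k}"
    using strict_mono_step_index_iff[of "order_time p"] assms by (auto simp: valid_policy_def)
  then show ?thesis by simp
next
  case False
  have "\<not> order_time p k \<le> t" for k
    using False assms strict_mono_less_eq[of "order_time p" 0 k] by (auto simp: valid_policy_def)
  then show ?thesis by simp
qed

text \<open>On \<open>{a..b}\<close> only the finitely many orders placed up to \<open>b\<close>
  matter, so the inventory is there a finite sum of step functions minus the identity.\<close>

lemma inventory_integrable:
  assumes "valid_policy p"
  shows "inventory p integrable_on {a..b}"
proof -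
  have fin: "finite {k. order_time p k \<le> b}" using finite_orders_upto assms .
  have "(\<lambda>t. \<Sum>k | order_time p k \<le> b. if t \<in> {order_time p k..} then order_qty p k else 0)
          integrable_on {a..b}"
  proof (intro integrable_sum fin)
    fix k
    have eq: "{order_time p k..} \<inter> {a..b} = {max (order_time p k) a..b}" by auto
    show "(\<lambda>t. if t \<in> {order_time p k..} then order_qty p k else 0) integrable_on {a..b}"
      unfolding integrable_restrict_Int eq by (rule integrable_const_ivl)
  qed
  then have "(\<lambda>t. (\<Sum>k | order_time p k \<le> b. if t \<in> {order_time p k..} then order_qty p k else 0) - t)
      integrable_on {a..b}"
    by (intro integrable_diff ident_integrable_on)
  moreover have "(\<Sum>k | order_time p k \<le> b. if t \<in> {order_time p k..} then order_qty p k else 0) - t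
      = inventory p t" if "t \<in> {a..b}" for t
  proof -
    have "(\<Sum>k | order_time p k \<le> b. if t \<in> {order_time p k..} then order_qty p k else 0)
       = sum (order_qty p) ({k. order_time p k \<le> b} \<inter> {k. order_time p k \<le> t})"
      using fin by (subst sum.inter_restrict) (auto intro!: sum.cong)
    also have "{k. order_time p k \<le> b} \<inter> {k. order_time p k \<le> t} = {k. order_time p k \<le> t}"
      using that by auto
    finally show ?thesis by (simp add: inventory_def)
  qed
  ultimately show ?thesis by (rule integrable_eq)
qed

lemma inventory_nonneg: "valid_policy p \<Longrightarrow> 0 \<le> t \<Longrightarrow> 0 \<le> inventory p t"
  by (simp add: valid_policy_def)

lemma order_time_nonneg: "valid_policy p \<Longrightarrow> 0 \<le> order_time p k"
  using strict_mono_less_eq[of "order_time p" 0 k] by (simp add: valid_policy_def)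

lemma integral_inventory_nonneg:
  "valid_policy p \<Longrightarrow> 0 \<le> a \<Longrightarrow> 0 \<le> integral {a..b} (inventory p)"
  by (intro integral_nonneg inventory_integrable) (auto intro: inventory_nonneg)

lemma cost_upto_mono:
  assumes "valid_policy p" "0 \<le> order_cost W i" "0 \<le> hold_cost W i" "0 \<le> s" "s \<le> t"
  shows "cost_upto W i p s \<le> cost_upto W i p t"
proof -
  have "finite {k. order_time p k \<in> {0..<t}}"
    by (rule finite_subset[OF _ finite_orders_upto[OF assms(1), of t]]) auto
  then have "num_orders p {0..<s} \<le> num_orders p {0..<t}"
    unfolding num_orders_def using assms by (intro card_mono) auto
  moreover have "integral {0..s} (inventory p) \<le> integral {0..t} (inventory p)"
    using assms by (intro integral_subset_le inventory_integrable) (auto intro: inventory_nonneg)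
  ultimately show ?thesis
    unfolding cost_upto_def using assms by (intro add_mono mult_left_mono) auto
qed

lemma cost_upto_nonneg:
  assumes "valid_policy p" "0 \<le> order_cost W i" "0 \<le> hold_cost W i"
  shows "0 \<le> cost_upto W i p t"
  unfolding cost_upto_def using assms integral_inventory_nonneg[of p 0 t] by auto

lemma avg_cost_nonneg:
  assumes "valid_policy p" "0 \<le> order_cost W i" "0 \<le> hold_cost W i"
  shows "0 \<le> avg_cost W i p"
proof -
  have "eventually (\<lambda>t::real. 0 \<le> ereal (cost_upto W i p t / t)) at_top"
    using eventually_ge_at_top[of 0]
    by eventually_elim (use cost_upto_nonneg[OF assms] in simp)
  then have "Limsup at_top (\<lambda>t::real. 0::ereal) \<le> avg_cost W i p"
    unfolding avg_cost_def by (intro Limsup_mono)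
  then show ?thesis by (simp add: Limsup_const)
qed

text \<open>After division by \<open>t\<close> the offset contributes \<open>c * d / t\<close>,
  which vanishes in the limit. The offset will be a cycle length, since the last cycle before
  \<open>t\<close> may be incomplete.\<close>

lemma avg_cost_le_of_affine_bound:
  assumes "\<And>t. 0 < t \<Longrightarrow> cost_upto W i p t \<le> c * (t + d)"
  shows "avg_cost W i p \<le> ereal c"
proof -
  have "((\<lambda>t::real. c * (1 + d * inverse t)) \<longlongrightarrow> c * (1 + d * 0)) at_top"
    by (intro tendsto_intros tendsto_inverse_0_at_top filterlim_ident)
  then have lim: "((\<lambda>t::real. ereal (c * (1 + d * inverse t))) \<longlongrightarrow> ereal c) at_top"
    by simp
  have "avg_cost W i p \<le> Limsup at_top (\<lambda>t::real. ereal (c * (1 + d * inverse t)))"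
    unfolding avg_cost_def
  proof (rule Limsup_mono)
    show "eventually (\<lambda>t. ereal (cost_upto W i p t / t) \<le> ereal (c * (1 + d * inverse t))) at_top"
      using eventually_gt_at_top[of 0]
    proof eventually_elim
      case (elim t)
      then show ?case using assms[OF elim] by (simp add: field_simps)
    qed
  qed
  also have "\<dots> = ereal c" by (rule lim_imp_Limsup[OF _ lim]) simp
  finally show ?thesis .
qed

section \<open>Policies that repeat one cycle\<close>

text \<open>The last order of a cycle raises the cumulative quantity to \<open>\<tau>\<close>, so that each
  cycle starts from and ends with an empty warehouse; otherwise repeating the order at offset
  0 with the same quantity would not reproduce the inventory of the first cycle.\<close>

locale order_cycle =
  fixes N :: nat and x a :: "nat \<Rightarrow> real" and \<tau> :: real
  assumes N_pos: "0 < N"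
    and x_0: "x 0 = 0"
    and x_step: "r < N \<Longrightarrow> x r < x (Suc r)"
    and x_N: "x N = \<tau>"
    and a_last: "a (N - 1) = \<tau>"
    and a_ge: "r < N \<Longrightarrow> x (Suc r) \<le> a r"
begin

text \<open>The total quantity of the orders \<open>0, ..., k\<close>: \<open>a r\<close> is the
  total after order \<open>r\<close> of the first cycle, and every full cycle delivers
  \<open>\<tau>\<close>, which is its demand.\<close>

definition cumulative :: "nat \<Rightarrow> real" where
  "cumulative k = real (k div N) * \<tau> + a (k mod N)"

text \<open>Quantities are differences of prescribed totals, so that their sums telescope. Some may
  be zero or negative; such orders remain orders and are charged.\<close>

definition repeated :: policy where
  "repeated = \<lparr>order_time = \<lambda>k. real (k div N) * \<tau> + x (k mod N),
     order_qty = \<lambda>k. case k of 0 \<Rightarrow> cumulative 0 | Suc j \<Rightarrow> cumulative (Suc j) - cumulative j\<rparr>"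

lemma time_repeated: "order_time repeated k = real (k div N) * \<tau> + x (k mod N)"
  by (simp add: repeated_def)

lemma cycle_pos: "0 < \<tau>"
  using x_step[of 0] increasing_steps_imp_mono[where x = x and N = N, OF x_step, of 1 N] N_pos x_0 x_N by simp

text \<open>The right-hand side keeps the old quotient, so the last gap of a cycle is no special
  case: there \<open>x N = \<tau>\<close> is the start of the next cycle.\<close>

lemma time_Suc: "order_time repeated (Suc k) = real (k div N) * \<tau> + x (Suc (k mod N))"
proof (cases "Suc (k mod N) = N")
  case True
  then have "Suc k mod N = 0" "Suc k div N = Suc (k div N)"
    by (simp_all add: mod_Suc div_Suc)
  then show ?thesis using True x_0 x_N by (simp add: time_repeated algebra_simps)
next
  case False
  then have "Suc k mod N = Suc (k mod N)" "Suc k div N = k div N"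
    by (simp_all add: mod_Suc div_Suc)
  then show ?thesis by (simp add: time_repeated)
qed

lemma strict_mono_time: "strict_mono (order_time repeated)"
  unfolding strict_mono_Suc_iff
proof
  fix k
  show "order_time repeated k < order_time repeated (Suc k)"
    using x_step[of "k mod N"] N_pos unfolding time_Suc by (simp add: time_repeated)
qed

lemma sum_qty: "(\<Sum>j\<le>k. order_qty repeated j) = cumulative k"
  by (induction k) (simp_all add: repeated_def)

lemma time_add_cycles: "order_time repeated (j * N + k) = real j * \<tau> + order_time repeated k"
  using N_pos by (simp add: time_repeated algebra_simps)

lemma cumulative_add_cycles: "cumulative (j * N + k) = real j * \<tau> + cumulative k"
  using N_pos by (simp add: cumulative_def algebra_simps)

text \<open>The critical order is the first of a later cycle, whose quantity is a difference to the
  last total of the cycle before. By \<open>a_last\<close> that total is a full multiple of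
  \<open>\<tau>\<close>, so \<open>cumulative 0\<close> remains, as at time 0.\<close>

lemma qty_add_cycles: "order_qty repeated (j * N + k) = order_qty repeated k"
proof (cases k)
  case (Suc l)
  then show ?thesis
    using cumulative_add_cycles[of j l] cumulative_add_cycles[of j "Suc l"]
    by (simp add: repeated_def)
next
  case 0
  show ?thesis
  proof (cases j)
    case (Suc i)
    have eq: "j * N = Suc (i * N + (N - 1))" using Suc N_pos by simp
    have "cumulative (i * N + (N - 1)) = real i * \<tau> + \<tau>"
      using cumulative_add_cycles[of i "N - 1"] a_last N_pos unfolding cumulative_def by simp
    moreover have "cumulative (j * N) = real j * \<tau> + cumulative 0"
      using cumulative_add_cycles[of j 0] by simp
    moreover have "order_qty repeated (j * N) = cumulative (j * N) - cumulative (i * N + (N - 1))"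
      unfolding eq by (simp add: repeated_def)
    moreover have "order_qty repeated 0 = cumulative 0" by (simp add: repeated_def)
    ultimately show ?thesis using 0 Suc by (simp add: algebra_simps)
  qed (simp add: 0)
qed

lemma obtain_step:
  assumes "s \<in> {0..<\<tau>}"
  obtains r where "r < N" "x r \<le> s" "s < x (Suc r)"
proof -
  define l where "l = (LEAST n. x n > s)"
  have ex: "x N > s" using assms x_N by simp
  have l: "x l > s" unfolding l_def by (rule LeastI[of _ N]) (rule ex)
  have "l \<le> N" unfolding l_def by (rule Least_le) (rule ex)
  have "l \<noteq> 0" using l assms x_0 by (intro notI) simp
  then obtain k where k: "l = Suc k" using not0_implies_Suc by blast
  have "\<not> x k > s" using k unfolding l_def by (metis lessI not_less_Least)
  then show ?thesis using that[of k] l k \<open>l \<le> N\<close> by simp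
qed

text \<open>Each cycle adds \<open>\<tau>\<close> both to the quantity ordered and to the demand, so
  the inventory is periodic.\<close>

lemma inventory_repeated:
  assumes "r < N" "x r \<le> s" "s < x (Suc r)"
  shows "inventory repeated (real j * \<tau> + s) = a r - s"
proof -
  have "order_time repeated (j * N + r) \<le> real j * \<tau> + s"
    using assms by (simp add: time_add_cycles) (simp add: time_repeated)
  moreover have "real j * \<tau> + s < order_time repeated (Suc (j * N + r))"
    using assms by (simp add: time_Suc)
  ultimately have "inventory repeated (real j * \<tau> + s) = cumulative (j * N + r) - (real j * \<tau> + s)"
    using inventory_between_orders[OF strict_mono_time] sum_qty by presburger
  then show ?thesis using assms by (simp add: cumulative_add_cycles) (simp add: cumulative_def)
qed

lemma inventory_repeated_nonneg:
  assumes "0 \<le> t"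
  shows "0 \<le> inventory repeated t"
proof -
  obtain j s where js: "t = real j * \<tau> + s" "s \<in> {0..<\<tau>}" using period_decomp cycle_pos assms .
  obtain r where "r < N" "x r \<le> s" "s < x (Suc r)" using obtain_step js(2) .
  then show ?thesis using inventory_repeated[of r s j] a_ge[of r] js by simp
qed

lemma valid_repeated: "valid_policy repeated"
proof -
  have "filterlim (order_time repeated) at_top sequentially"
    unfolding filterlim_at_top
  proof
    fix Z :: real
    obtain n :: nat where n: "Z < real n * \<tau>" using reals_Archimedean3[OF cycle_pos] by blast
    show "eventually (\<lambda>k. Z \<le> order_time repeated k) sequentially"
    proof (rule eventually_sequentiallyI)
      fix k assume "n * N \<le> k"
      then have "order_time repeated (n * N) \<le> order_time repeated k"
        using strict_mono_time by (simp add: strict_mono_less_eq)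
      then show "Z \<le> order_time repeated k"
        using n time_add_cycles[of n 0] x_0 time_repeated[of 0] by simp
    qed
  qed
  moreover have "order_time repeated 0 = 0" using x_0 by (simp add: time_repeated)
  ultimately show ?thesis
    using strict_mono_time inventory_repeated_nonneg by (simp add: valid_policy_def)
qed

lemma order_at_repeated:
  assumes "s \<in> {0..<\<tau>}"
  shows "order_at repeated (real j * \<tau> + s) y \<longleftrightarrow> order_at repeated s y"
proof
  assume "order_at repeated s y"
  then show "order_at repeated (real j * \<tau> + s) y"
    unfolding order_at_def by (metis time_add_cycles qty_add_cycles)
next
  assume "order_at repeated (real j * \<tau> + s) y"
  then obtain k where k: "order_time repeated k = real j * \<tau> + s" "order_qty repeated k = y"
    unfolding order_at_def by blast
  \<comment> \<open>An order in cycle \<open>j\<close> or later has an index of at least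
    \<open>j * N\<close>, hence is the shift of an order by \<open>j\<close> whole cycles.\<close>
  have "order_time repeated (j * N) \<le> order_time repeated k"
    using k assms x_0 time_add_cycles[of j 0] by (simp add: time_repeated)
  then have "j * N \<le> k" using strict_mono_time by (simp add: strict_mono_less_eq)
  then obtain l where "k = j * N + l" using le_Suc_ex by blast
  then show "order_at repeated s y"
    using k unfolding order_at_def by (metis add_left_cancel time_add_cycles qty_add_cycles)
qed

lemma num_orders_repeated: "num_orders repeated {0..<real n * \<tau>} = n * N"
proof -
  have "order_time repeated (n * N) = real n * \<tau>"
    using time_add_cycles[of n 0] x_0 by (simp add: time_repeated)
  then have "{k. order_time repeated k \<in> {0..<real n * \<tau>}} = {..<n * N}"
    using order_time_nonneg[OF valid_repeated] strict_mono_less[OF strict_mono_time, of _ "n * N"]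
    by auto
  then show ?thesis by (simp add: num_orders_def)
qed

lemma integral_repeated:
  "integral {0..real n * \<tau>} (inventory repeated) = real n * integral {0..\<tau>} (inventory repeated)"
proof (induction n)
  case (Suc n)
  let ?f = "inventory repeated"
  have int: "?f integrable_on {u..v}" for u v by (rule inventory_integrable[OF valid_repeated])
  have "(?f has_integral integral {real n * \<tau>..real (Suc n) * \<tau>} ?f) {0 + real n * \<tau>..\<tau> + real n * \<tau>}"
    using integrable_integral[OF int[of "real n * \<tau>" "real (Suc n) * \<tau>"]] by (simp add: algebra_simps)
  then have sh: "((\<lambda>s. ?f (s + real n * \<tau>)) has_integral integral {real n * \<tau>..real (Suc n) * \<tau>} ?f) {0..\<tau>}"
    by (rule has_integral_shift_real)
  \<comment> \<open>Offsets within a cycle form a half-open interval, so the two integrands are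
    compared away from the endpoint \<open>\<tau>\<close>.\<close>
  have "(?f has_integral integral {real n * \<tau>..real (Suc n) * \<tau>} ?f) {0..\<tau>}"
  proof (rule has_integral_spike_finite[OF _ _ sh])
    show "finite {\<tau>}" by simp
    fix s assume "s \<in> {0..\<tau>} - {\<tau>}"
    then have "s \<in> {0..<\<tau>}" by auto
    then obtain r where "r < N" "x r \<le> s" "s < x (Suc r)" using obtain_step by blast
    then show "?f s = ?f (s + real n * \<tau>)"
      using inventory_repeated[of r s n] inventory_repeated[of r s 0] by (simp add: add.commute)
  qed
  then have "integral {real n * \<tau>..real (Suc n) * \<tau>} ?f = integral {0..\<tau>} ?f"
    by (simp add: integral_unique)
  moreover have "integral {0..real n * \<tau>} ?f + integral {real n * \<tau>..real (Suc n) * \<tau>} ?f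
      = integral {0..real (Suc n) * \<tau>} ?f"
    by (rule Henstock_Kurzweil_Integration.integral_combine[OF _ _ int]) (use cycle_pos in \<open>auto simp: mult_right_mono\<close>)
  ultimately show ?case using Suc by (simp add: algebra_simps)
qed simp

text \<open>Costs are monotone in time, so the cost up to \<open>t\<close> is at most that of the
  complete cycles before \<open>t\<close> and one more, which end no later than
  \<open>t + \<tau>\<close>.\<close>

lemma avg_cost_repeated_le:
  assumes "0 \<le> order_cost W i" "0 \<le> hold_cost W i"
  shows "avg_cost W i repeated \<le>
    ereal ((order_cost W i * real N + 2 * hold_cost W i * integral {0..\<tau>} (inventory repeated)) / \<tau>)"
    (is "_ \<le> ereal (?c / \<tau>)")
proof (rule avg_cost_le_of_affine_bound)
  fix t :: real assume "0 < t"
  then obtain j s where js: "t = real j * \<tau> + s" "s \<in> {0..<\<tau>}"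
    using period_decomp[OF cycle_pos, of t] by auto
  have c: "0 \<le> ?c" using assms integral_inventory_nonneg[OF valid_repeated, of 0 \<tau>] by simp
  have "cost_upto W i repeated t \<le> cost_upto W i repeated (real (Suc j) * \<tau>)"
    using js \<open>0 < t\<close> by (intro cost_upto_mono valid_repeated assms) (auto simp: algebra_simps)
  also have "\<dots> = real (Suc j) * ?c"
    unfolding cost_upto_def num_orders_repeated integral_repeated by (simp add: algebra_simps)
  also have "\<dots> = ?c / \<tau> * (real (Suc j) * \<tau>)" using cycle_pos by simp
  also have "\<dots> \<le> ?c / \<tau> * (t + \<tau>)"
    using js c cycle_pos by (intro mult_left_mono) (auto simp: algebra_simps)
  finally show "cost_upto W i repeated t \<le> ?c / \<tau> * (t + \<tau>)" .
qed

end

section \<open>Cutting a window out of a policy\<close>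

text \<open>The orders strictly inside the window split it into \<open>N\<close> pieces.
  \<open>Q r\<close> is the total ordered by \<open>p\<close> since time 0, as valid on piece
  \<open>r\<close>. It covers all demand up to the end of the piece because the inventory is
  nonnegative until then.\<close>

lemma window_breakpoints:
  fixes p :: policy and a b :: real
  assumes p: "valid_policy p" and ab: "0 \<le> a" "a < b"
  defines "N \<equiv> Suc (card {k. order_time p k \<in> {a<..<b}})"
  obtains x Q :: "nat \<Rightarrow> real" where
    "x 0 = a" "x N = b" "\<And>r. r < N \<Longrightarrow> x r < x (Suc r)"
    "\<And>r t. r < N \<Longrightarrow> x r \<le> t \<Longrightarrow> t < x (Suc r) \<Longrightarrow> inventory p t = Q r - t"
    "\<And>r. r < N \<Longrightarrow> x (Suc r) \<le> Q r"
proof -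
  have mono: "strict_mono (order_time p)" and div: "filterlim (order_time p) at_top sequentially"
    and "order_time p 0 = 0"
    using p by (auto simp: valid_policy_def)
  then obtain k where k: "order_time p k \<le> a" "a < order_time p (Suc k)"
    using step_in_divergent_seq[OF div, of a] ab by auto
  obtain n where n: "b \<le> order_time p n"
    using div unfolding filterlim_at_top eventually_sequentially by blast
  \<comment> \<open>\<open>k\<close> is the last order at or before \<open>a\<close>, and
    \<open>l\<close> the first at or after \<open>b\<close>; those strictly inside are
    \<open>Suc k, ..., l - 1\<close>.\<close>
  define l where "l = (LEAST n. b \<le> order_time p n)"
  have l: "b \<le> order_time p l" unfolding l_def using n by (rule LeastI)
  have less_l: "order_time p j < b \<longleftrightarrow> j < l" for j
  proof
    show "j < l" if "order_time p j < b"
      using that l mono strict_mono_less[OF mono, of j l] by simp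
    show "order_time p j < b" if "j < l"
      using that not_less_Least[of j "\<lambda>n. b \<le> order_time p n"] unfolding l_def by simp
  qed
  have kl: "k < l" using less_l[of k] k ab by simp
  have gt_a: "a < order_time p j \<longleftrightarrow> k < j" for j
    using strict_mono_step_index_iff[OF mono k, of j] by (simp add: not_le[symmetric])
  have "{j. order_time p j \<in> {a<..<b}} = {Suc k..<l}"
    using less_l gt_a by auto
  then have N: "N = l - k" using kl unfolding N_def by simp
  define x where "x r = (if r = 0 then a else if r = N then b else order_time p (k + r))" for r
  define Q where "Q r = (\<Sum>j\<le>k + r. order_qty p j)" for r
  have x_ge: "order_time p (k + r) \<le> x r" if "r < N" for r
    using k that by (simp add: x_def)
  have x_le: "x (Suc r) \<le> order_time p (Suc (k + r))" if "r < N" for r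
  proof (cases "Suc r = N")
    case True
    then have "Suc (k + r) = l" using N kl by simp
    then show ?thesis using True l by (simp add: x_def)
  qed (simp add: x_def)
  have step: "x r < x (Suc r)" if "r < N" for r
  proof (cases "r = 0")
    case True
    then show ?thesis using k ab by (simp add: x_def)
  next
    case False
    then have "order_time p (k + r) < order_time p (Suc (k + r))" "order_time p (k + r) < b"
      using less_l[of "k + r"] that N strict_mono_less[OF mono] by auto
    then show ?thesis using that False by (simp add: x_def)
  qed
  have inv: "inventory p t = Q r - t" if "r < N" "x r \<le> t" "t < x (Suc r)" for r t
    unfolding Q_def
    by (rule inventory_between_orders[OF mono]) (use x_ge[of r] x_le[of r] that in simp_all)
  have x_nonneg: "0 \<le> x r" if "r < N" for r
    using that order_time_nonneg[OF p] ab by (simp add: x_def)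
  \<comment> \<open>An order at \<open>x (Suc r)\<close> may change the level, so nonnegativity is
    used for \<open>t < x (Suc r)\<close> only, and density gives the bound at the end.\<close>
  have "x (Suc r) \<le> Q r" if r: "r < N" for r
  proof (rule dense_le_bounded[OF step[OF r]])
    fix t assume "x r < t" "t < x (Suc r)"
    then show "t \<le> Q r"
      using inv[of r t] inventory_nonneg[OF p, of t] x_nonneg[OF r] r by simp
  qed
  moreover have "x 0 = a" "x N = b" using N kl by (auto simp: x_def)
  ultimately show ?thesis using that step inv by blast
qed

text \<open>The totals \<open>Q r\<close> are shifted by \<open>a\<close> and capped at the cycle
  length \<open>b - a\<close>. The cap only lowers the inventory and still covers the demand of the
  cycle. The first of the \<open>N\<close> orders supplies the stock that \<open>p\<close> holds at
  \<open>a\<close>; the others are the interior orders of \<open>p\<close>.\<close>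

lemma cyclic_policy_from_window:
  fixes p :: policy and a b :: real
  assumes p: "valid_policy p" and ab: "0 \<le> a" "a < b"
    and W: "0 \<le> order_cost W i" "0 \<le> hold_cost W i"
  defines "N \<equiv> Suc (card {k. order_time p k \<in> {a<..<b}})"
  shows "\<exists>q. valid_policy q \<and>
    (\<forall>j. \<forall>s\<in>{0..<b - a}. \<forall>y. order_at q (real j * (b - a) + s) y \<longleftrightarrow> order_at q s y) \<and>
    num_orders q {0..<b - a} = N \<and>
    (\<forall>j. \<forall>s\<in>{0..<b - a}. inventory q (real j * (b - a) + s) \<le> inventory p (a + s)) \<and>
    avg_cost W i q \<le>
      ereal ((order_cost W i * real N + 2 * hold_cost W i * integral {a..b} (inventory p)) / (b - a))"
proof -
  obtain x Q where x: "x 0 = a" "x N = b" "\<And>r. r < N \<Longrightarrow> x r < x (Suc r)"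
    and inv: "\<And>r t. r < N \<Longrightarrow> x r \<le> t \<Longrightarrow> t < x (Suc r) \<Longrightarrow> inventory p t = Q r - t"
    and Q: "\<And>r. r < N \<Longrightarrow> x (Suc r) \<le> Q r"
    using window_breakpoints[OF p ab] unfolding N_def by blast
  have N_pos: "0 < N" by (simp add: N_def)
  define x' where "x' r = x r - a" for r
  define Q' where "Q' r = min (Q r - a) (b - a)" for r
  interpret order_cycle N x' Q' "b - a"
  proof
    \<comment> \<open>The last total covers the demand up to \<open>b\<close>, so the cap is
      attained.\<close>
    show "Q' (N - 1) = b - a"
      using Q[of "N - 1"] N_pos x by (simp add: Q'_def)
    show "x' (Suc r) \<le> Q' r" if "r < N" for r
      using Q[of r] that increasing_steps_imp_mono[where x = x and N = N, OF x(3), of "Suc r" N] x by (simp add: x'_def Q'_def)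
  qed (use N_pos x in \<open>auto simp: x'_def\<close>)
  have le: "inventory repeated (real j * (b - a) + s) \<le> inventory p (a + s)"
    if s: "s \<in> {0..<b - a}" for j s
  proof -
    obtain r where r: "r < N" "x' r \<le> s" "s < x' (Suc r)" using obtain_step s .
    then show ?thesis
      using inventory_repeated[OF r, of j] inv[of r "a + s"] by (simp add: x'_def Q'_def)
  qed
  have "((inventory p) has_integral integral {a..b} (inventory p)) {0 + a..(b - a) + a}"
    using integrable_integral[OF inventory_integrable[OF p, of a b]] by simp
  then have sh: "((\<lambda>s. inventory p (s + a)) has_integral integral {a..b} (inventory p)) {0..b - a}"
    by (rule has_integral_shift_real)
  \<comment> \<open>At \<open>b - a\<close> the repeated policy has already ordered for the next
    cycle and may hold more than \<open>p\<close>; the integrand is redefined at this point.\<close>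
  have "((\<lambda>s. if s = b - a then inventory repeated s else inventory p (s + a))
      has_integral integral {a..b} (inventory p)) {0..b - a}"
    by (rule has_integral_spike_finite[OF _ _ sh, of "{b - a}"]) auto
  then have "integral {0..b - a} (inventory repeated) \<le> integral {a..b} (inventory p)"
  proof (rule has_integral_le[OF integrable_integral[OF inventory_integrable[OF valid_repeated]]])
    fix s assume "s \<in> {0..b - a}"
    then show "inventory repeated s \<le> (if s = b - a then inventory repeated s else inventory p (s + a))"
      using le[of s 0] by (auto simp: add.commute)
  qed
  then have "(order_cost W i * real N + 2 * hold_cost W i * integral {0..b - a} (inventory repeated)) / (b - a)
     \<le> (order_cost W i * real N + 2 * hold_cost W i * integral {a..b} (inventory p)) / (b - a)"
    using W ab by (intro divide_right_mono add_mono mult_left_mono) auto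
  then have "avg_cost W i repeated \<le>
      ereal ((order_cost W i * real N + 2 * hold_cost W i * integral {a..b} (inventory p)) / (b - a))"
    using avg_cost_repeated_le[OF W] by (meson ereal_less_eq(3) order_trans)
  moreover have "num_orders repeated {0..<b - a} = N"
    using num_orders_repeated[of 1] by simp
  ultimately show ?thesis
    using valid_repeated order_at_repeated le by blast
qed

text \<open>The longest of the \<open>N\<close> gaps between consecutive orders has length at least
  \<open>(b - a) / N\<close>, and just before an order the inventory must cover the rest of the gap.\<close>

lemma integral_inventory_window_ge:
  fixes p :: policy and a b :: real
  assumes p: "valid_policy p" and ab: "0 \<le> a" "a < b"
  defines "N \<equiv> Suc (card {k. order_time p k \<in> {a<..<b}})"
  shows "((b - a) / real N)\<^sup>2 / 2 \<le> integral {a..b} (inventory p)"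
proof -
  obtain x Q where x: "x 0 = a" "x N = b" "\<And>r. r < N \<Longrightarrow> x r < x (Suc r)"
    and inv: "\<And>r t. r < N \<Longrightarrow> x r \<le> t \<Longrightarrow> t < x (Suc r) \<Longrightarrow> inventory p t = Q r - t"
    and Q: "\<And>r. r < N \<Longrightarrow> x (Suc r) \<le> Q r"
    using window_breakpoints[OF p ab] unfolding N_def by blast
  have N_pos: "0 < N" by (simp add: N_def)
  have "\<exists>r<N. (b - a) / real N \<le> x (Suc r) - x r"
  proof (rule ccontr)
    assume "\<not> ?thesis"
    then have "(\<Sum>r<N. x (Suc r) - x r) < (\<Sum>r<N. (b - a) / real N)"
      using N_pos by (intro sum_strict_mono) (auto simp: not_le)
    moreover have "(\<Sum>r<N. x (Suc r) - x r) = b - a"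
      using sum_lessThan_telescope[of x N] x by simp
    ultimately show False using N_pos by simp
  qed
  then obtain r where r: "r < N" "(b - a) / real N \<le> x (Suc r) - x r" by blast
  let ?u = "x r" and ?v = "x (Suc r)"
  have uv: "?u < ?v" "a \<le> ?u" "?v \<le> b"
    using x(3)[of r] increasing_steps_imp_mono[where x = x and N = N, OF x(3), of 0 r] increasing_steps_imp_mono[where x = x and N = N, OF x(3), of "Suc r" N] r x by simp_all
  have "((\<lambda>t. ?v - t) has_integral (?v - ?u) * ?v - (?v\<^sup>2 - ?u\<^sup>2) / 2) {?u..?v}"
    using has_integral_diff[OF has_integral_const_real[of ?v ?u ?v] ident_has_integral[of ?u ?v]] uv
    by simp
  then have tri: "((\<lambda>t. ?v - t) has_integral (?v - ?u)\<^sup>2 / 2) {?u..?v}"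
    by (rule has_integral_eq_rhs) (simp add: power2_eq_square field_simps)
  have "((b - a) / real N)\<^sup>2 / 2 \<le> (?v - ?u)\<^sup>2 / 2"
    using r ab by (intro divide_right_mono power_mono) auto
  also have "\<dots> \<le> integral {?u..?v} (inventory p)"
  proof (rule has_integral_le[OF tri integrable_integral[OF inventory_integrable[OF p]]])
    fix t assume t: "t \<in> {?u..?v}"
    show "?v - t \<le> inventory p t"
    proof (cases "t = ?v")
      case True
      then show ?thesis using inventory_nonneg[OF p, of t] uv ab by simp
    next
      case False
      then show ?thesis using inv[of r t] Q[of r] r t by simp
    qed
  qed
  also have "\<dots> \<le> integral {a..b} (inventory p)"
    using uv ab by (intro integral_subset_le inventory_integrable p) (auto intro: inventory_nonneg[OF p])
  finally show ?thesis .
qed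

section \<open>Counting orders in windows\<close>

text \<open>An order at \<open>t\<close> itself is counted. As indices start from 0, for a valid
  policy and \<open>t \<ge> 0\<close> this is also the index of the first order after
  \<open>t\<close>.\<close>

definition orders_upto :: "policy \<Rightarrow> real \<Rightarrow> nat" where
  "orders_upto p t = card {k. order_time p k \<le> t}"

text \<open>The number of orders per cycle when the window is repeated: \<open>Suc\<close> stands
  for the order that opens the cycle, whether or not \<open>p\<close> orders at \<open>a\<close>,
  and an order at \<open>b\<close> is left out.\<close>

definition window_orders :: "policy \<Rightarrow> real \<Rightarrow> real \<Rightarrow> nat" where
  "window_orders p a b = Suc (card {k. order_time p k \<in> {a<..<b}})"

lemma order_time_le_iff:
  assumes p: "valid_policy p" and t: "0 \<le> t"
  shows "order_time p k \<le> t \<longleftrightarrow> k < orders_upto p t"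
proof -
  have mono: "strict_mono (order_time p)" using p by (simp add: valid_policy_def)
  obtain l where l: "order_time p l \<le> t" "t < order_time p (Suc l)"
    using p t step_in_divergent_seq[of "order_time p" t] by (auto simp: valid_policy_def)
  have "{k. order_time p k \<le> t} = {..l}"
    using strict_mono_step_index_iff[OF mono l] by auto
  then show ?thesis using strict_mono_step_index_iff[OF mono l] by (simp add: orders_upto_def less_Suc_eq_le)
qed

lemma orders_upto_0:
  assumes "valid_policy p"
  shows "orders_upto p 0 = 1"
proof -
  have "strict_mono (order_time p)" "order_time p 0 = 0" using assms by (auto simp: valid_policy_def)
  then have "order_time p k \<le> 0 \<longleftrightarrow> k = 0" for k
    using strict_mono_less_eq[of "order_time p" k 0] by simp
  then show ?thesis by (simp add: orders_upto_def)
qed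

text \<open>Times increase strictly, so at most one order falls on \<open>t\<close> itself, the
  point missing from the half-open interval.\<close>

lemma orders_upto_le_num_orders:
  assumes p: "valid_policy p" and t: "0 \<le> t"
  shows "orders_upto p t \<le> Suc (num_orders p {0..<t})"
proof -
  let ?n = "orders_upto p t"
  have mono: "strict_mono (order_time p)" using p by (simp add: valid_policy_def)
  have "{..<?n - 1} \<subseteq> {k. order_time p k \<in> {0..<t}}"
  proof
    fix k assume "k \<in> {..<?n - 1}"
    then have "order_time p k < order_time p (Suc k)" "order_time p (Suc k) \<le> t"
      using strict_mono_less[OF mono] order_time_le_iff[OF p t] by auto
    then show "k \<in> {k. order_time p k \<in> {0..<t}}" using order_time_nonneg[OF p] by simp
  qed
  moreover have "finite {k. order_time p k \<in> {0..<t}}"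
    by (rule finite_subset[OF _ finite_orders_upto[OF p, of t]]) auto
  ultimately have "card {..<?n - 1} \<le> num_orders p {0..<t}"
    unfolding num_orders_def by (intro card_mono)
  then show ?thesis by simp
qed

text \<open>The index \<open>orders_upto p s + m - 1\<close> is that of the \<open>m\<close>-th
  order after \<open>s\<close>. If it is placed by \<open>b\<close>, the \<open>m - 1\<close> orders
  before it lie strictly inside the window; with the opening order this makes \<open>m\<close>, and
  no more if the \<open>m\<close>-th order is at \<open>b\<close>.\<close>

lemma window_orders_bounds:
  assumes p: "valid_policy p" and s: "0 \<le> s" and m: "0 < m"
    and le: "order_time p (orders_upto p s + m - 1) \<le> b"
  shows "s < b" "orders_upto p s + m \<le> orders_upto p b"
    "m \<le> window_orders p s b"
    "window_orders p s b \<le> Suc (orders_upto p b - orders_upto p s)"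
    "order_time p (orders_upto p s + m - 1) = b \<Longrightarrow> window_orders p s b = m"
proof -
  let ?n = "orders_upto p s"
  have mono: "strict_mono (order_time p)" using p by (simp add: valid_policy_def)
  have gt: "s < order_time p k \<longleftrightarrow> ?n \<le> k" for k
    using order_time_le_iff[OF p s, of k] by linarith
  have "?n \<le> ?n + m - 1" using m by linarith
  then show "s < b" using gt[of "?n + m - 1"] le by linarith
  then have b: "0 \<le> b" using s by simp
  show "?n + m \<le> orders_upto p b" using order_time_le_iff[OF p b] le m by fastforce
  have fin: "finite {k. order_time p k \<in> {s<..<b}}"
    by (rule finite_subset[OF _ finite_orders_upto[OF p, of b]]) auto
  have sub: "{?n..<?n + m - 1} \<subseteq> {k. order_time p k \<in> {s<..<b}}"
  proof
    fix k assume k: "k \<in> {?n..<?n + m - 1}"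
    then have "order_time p k < order_time p (?n + m - 1)" using strict_mono_less[OF mono] by simp
    then show "k \<in> {k. order_time p k \<in> {s<..<b}}" using gt k le by simp
  qed
  show "m \<le> window_orders p s b"
    using card_mono[OF fin sub] m unfolding window_orders_def by simp
  have "{k. order_time p k \<in> {s<..<b}} \<subseteq> {?n..<orders_upto p b}"
    using gt order_time_le_iff[OF p b] by fastforce
  from card_mono[OF _ this] show "window_orders p s b \<le> Suc (orders_upto p b - ?n)"
    unfolding window_orders_def by simp
  assume eq: "order_time p (?n + m - 1) = b"
  have "{k. order_time p k \<in> {s<..<b}} \<subseteq> {?n..<?n + m - 1}"
    using gt eq strict_mono_less[OF mono] by auto
  with sub have "{k. order_time p k \<in> {s<..<b}} = {?n..<?n + m - 1}" by blast
  then show "window_orders p s b = m" using m unfolding window_orders_def by simp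
qed

text \<open>The window ends when the slowest commodity places its \<open>m\<close>-th order after \<open>s\<close>. That
  final order is replaced by the one at the start of the cycle.\<close>

lemma ex_next_window:
  assumes I: "finite I" "I \<noteq> {}" and P: "\<And>i. i \<in> I \<Longrightarrow> valid_policy (P i)"
    and s: "0 \<le> s" and m: "0 < m"
  shows "\<exists>b>s. (\<forall>i\<in>I. m \<le> window_orders (P i) s b
      \<and> orders_upto (P i) s + m \<le> orders_upto (P i) b
      \<and> window_orders (P i) s b \<le> Suc (orders_upto (P i) b - orders_upto (P i) s))
    \<and> (\<exists>i\<in>I. window_orders (P i) s b = m)"
proof -
  let ?t = "\<lambda>i. order_time (P i) (orders_upto (P i) s + m - 1)"
  define b where "b = Max (?t ` I)"
  have le: "?t i \<le> b" if "i \<in> I" for i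
    unfolding b_def using I that by simp
  have "b \<in> ?t ` I" unfolding b_def using I by (intro Max_in) auto
  then obtain i0 where i0: "i0 \<in> I" "?t i0 = b" by blast
  note bounds = window_orders_bounds[OF P s m le]
  show ?thesis using bounds i0 by blast
qed

section \<open>Averaging over consecutive windows\<close>

text \<open>Passes from a sum of upper limits to a bound at common times. The average costs are
  nonnegative with sum below \<open>B\<close>, hence finite; the slack is shared equally among the
  commodities, and each is eventually below its upper limit plus its share.\<close>

lemma total_cost_eventually_less:
  assumes W: "valid_warehouse W" and P: "\<And>i. i \<in> commodities W \<Longrightarrow> valid_policy (P i)"
    and B: "total_cost W P < ereal B"
  shows "eventually (\<lambda>t. (\<Sum>i\<in>commodities W. cost_upto W i (P i) t / t) < B) at_top"
proof -
  let ?C = "commodities W"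
  have fin: "finite ?C" by (simp add: commodities_def)
  have n: "0 < card ?C" using W by (simp add: commodities_def valid_warehouse_def)
  have nonneg: "0 \<le> avg_cost W i (P i)" if "i \<in> ?C" for i
    using avg_cost_nonneg[OF P[OF that]] W that by (simp add: valid_warehouse_def less_imp_le)
  have "\<exists>c. avg_cost W i (P i) = ereal c" if i: "i \<in> ?C" for i
  proof -
    have "avg_cost W i (P i) \<le> total_cost W P"
      unfolding total_cost_def sum.remove[OF fin i]
      by (intro add_increasing2 sum_nonneg) (auto intro: nonneg)
    then have "avg_cost W i (P i) < \<infinity>" using B by (metis ereal_infty_less(1) less_ereal.simps(4) order_le_less_trans ereal_less_eq(1) less_irrefl)
    then show ?thesis using nonneg[OF i] by (cases "avg_cost W i (P i)") auto
  qed
  then obtain c where c: "\<And>i. i \<in> ?C \<Longrightarrow> avg_cost W i (P i) = ereal (c i)" by metis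
  have "total_cost W P = ereal (\<Sum>i\<in>?C. c i)" unfolding total_cost_def using c by simp
  then have lt: "(\<Sum>i\<in>?C. c i) < B" using B by simp
  define \<delta> where "\<delta> = (B - (\<Sum>i\<in>?C. c i)) / card ?C"
  have \<delta>: "0 < \<delta>" using lt n by (simp add: \<delta>_def)
  have "eventually (\<lambda>t. \<forall>i\<in>?C. ereal (cost_upto W i (P i) t / t) < ereal (c i + \<delta>)) at_top"
    unfolding eventually_ball_finite_distrib[OF fin]
  proof
    fix i assume "i \<in> ?C"
    then have "Limsup at_top (\<lambda>t. ereal (cost_upto W i (P i) t / t)) < ereal (c i + \<delta>)"
      using c \<delta> by (simp add: avg_cost_def[symmetric])
    then show "eventually (\<lambda>t. ereal (cost_upto W i (P i) t / t) < ereal (c i + \<delta>)) at_top"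
      by (rule Limsup_lessD)
  qed
  then show ?thesis
  proof eventually_elim
    case (elim t)
    then have "(\<Sum>i\<in>?C. cost_upto W i (P i) t / t) < (\<Sum>i\<in>?C. c i + \<delta>)"
      using fin n by (intro sum_strict_mono) auto
    also have "\<dots> = B" using n by (simp add: sum.distrib \<delta>_def)
    finally show ?case .
  qed
qed

text \<open>Divided by \<open>b - a\<close>, this is the bound on the average cost of the repeated
  window in \<open>cyclic_policy_from_window\<close>.\<close>

definition window_cost :: "warehouse \<Rightarrow> nat \<Rightarrow> policy \<Rightarrow> real \<Rightarrow> real \<Rightarrow> real" where
  "window_cost W i p a b =
     order_cost W i * real (window_orders p a b) + 2 * hold_cost W i * integral {a..b} (inventory p)"

text \<open>Averaging over consecutive windows. The factor \<open>1 + 1 / m\<close> pays for the order that starts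
  the cycle, since each commodity places at least \<open>m\<close> orders per window.\<close>

lemma ex_cheap_window:
  assumes W: "valid_warehouse W" and P: "\<And>i. i \<in> commodities W \<Longrightarrow> valid_policy (P i)"
    and B: "total_cost W P < ereal B" and m: "0 < m"
  shows "\<exists>a b. 0 \<le> a \<and> a < b \<and>
    (\<forall>i\<in>commodities W. m \<le> window_orders (P i) a b) \<and>
    (\<exists>i\<in>commodities W. window_orders (P i) a b = m) \<and>
    (\<Sum>i\<in>commodities W. window_cost W i (P i) a b) \<le> (1 + 1 / real m) * B * (b - a)"
proof (rule ccontr)
  assume contr: "\<not> ?thesis"
  let ?C = "commodities W"
  have fin: "finite ?C" and ne: "?C \<noteq> {}" using W by (auto simp: commodities_def valid_warehouse_def)
  have KH: "0 < order_cost W i" "0 < hold_cost W i" if "i \<in> ?C" for i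
    using W that by (auto simp: valid_warehouse_def)
  have "\<exists>b. 0 \<le> s \<longrightarrow> b > s \<and> (\<forall>i\<in>?C. m \<le> window_orders (P i) s b
      \<and> orders_upto (P i) s + m \<le> orders_upto (P i) b
      \<and> window_orders (P i) s b \<le> Suc (orders_upto (P i) b - orders_upto (P i) s))
    \<and> (\<exists>i\<in>?C. window_orders (P i) s b = m)" for s
    using ex_next_window[of ?C P s m] fin ne P m by blast
  then obtain nxt where nxt: "\<And>s. 0 \<le> s \<Longrightarrow> nxt s > s \<and> (\<forall>i\<in>?C. m \<le> window_orders (P i) s (nxt s)
      \<and> orders_upto (P i) s + m \<le> orders_upto (P i) (nxt s)
      \<and> window_orders (P i) s (nxt s) \<le> Suc (orders_upto (P i) (nxt s) - orders_upto (P i) s))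
    \<and> (\<exists>i\<in>?C. window_orders (P i) s (nxt s) = m)"
    by metis
  define s where "s j = (nxt ^^ j) 0" for j
  have s_0: "s 0 = 0" and s_Suc: "s (Suc j) = nxt (s j)" for j by (simp_all add: s_def)
  have s_nonneg: "0 \<le> s j" for j
    by (induction j) (use nxt in \<open>auto simp: s_0 s_Suc intro: less_imp_le order.strict_trans1\<close>)
  note step = nxt[OF s_nonneg, folded s_Suc]
  \<comment> \<open>Each commodity places at least one order per window, so order \<open>j\<close>
    is placed by \<open>s j\<close>; this later makes the window ends arbitrarily large.\<close>
  have upto_ge: "j < orders_upto (P i) (s j)" if i: "i \<in> ?C" for i j
  proof (induction j)
    case 0
    then show ?case using orders_upto_0[OF P[OF i]] by (simp add: s_0)
  next
    case (Suc j)
    have "orders_upto (P i) (s j) + m \<le> orders_upto (P i) (s (Suc j))" using step i by blast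
    then show ?case using Suc m by linarith
  qed
  \<comment> \<open>Orders at \<open>s j\<close> are included, so the increments of \<open>F\<close>
    count exactly the orders after \<open>s j\<close> up to and including
    \<open>s (Suc j)\<close>.\<close>
  define F where "F j = (\<Sum>i\<in>?C. order_cost W i * real (orders_upto (P i) (s j))
    + 2 * hold_cost W i * integral {0..s j} (inventory (P i)))" for j
  have window_le: "(\<Sum>i\<in>?C. window_cost W i (P i) (s j) (s (Suc j))) \<le> (1 + 1 / real m) * (F (Suc j) - F j)" for j
  proof -
    have "window_cost W i (P i) (s j) (s (Suc j)) \<le> (1 + 1 / real m) *
      ((order_cost W i * real (orders_upto (P i) (s (Suc j))) + 2 * hold_cost W i * integral {0..s (Suc j)} (inventory (P i)))
       - (order_cost W i * real (orders_upto (P i) (s j)) + 2 * hold_cost W i * integral {0..s j} (inventory (P i))))"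
      if i: "i \<in> ?C" for i
    proof -
      let ?a = "orders_upto (P i) (s j)" and ?b = "orders_upto (P i) (s (Suc j))"
      let ?I = "integral {s j..s (Suc j)} (inventory (P i))"
      have w: "?a + m \<le> ?b" "window_orders (P i) (s j) (s (Suc j)) \<le> Suc (?b - ?a)" using step i by blast+
      then have "real (window_orders (P i) (s j) (s (Suc j))) \<le> (real ?b - real ?a) + 1" by linarith
      also have "\<dots> \<le> (1 + 1 / real m) * (real ?b - real ?a)"
      proof -
        have "1 \<le> (real ?b - real ?a) / real m" using w m by (simp add: le_divide_eq)
        then show ?thesis by (simp add: algebra_simps diff_divide_distrib)
      qed
      finally have n: "real (window_orders (P i) (s j) (s (Suc j))) \<le> (1 + 1 / real m) * (real ?b - real ?a)" .
      have I0: "0 \<le> ?I" by (rule integral_inventory_nonneg[OF P[OF i] s_nonneg])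
      have I1: "?I \<le> (1 + 1 / real m) * ?I" using I0 m by (simp add: algebra_simps)
      have split: "integral {0..s j} (inventory (P i)) + ?I = integral {0..s (Suc j)} (inventory (P i))"
        using step s_nonneg by (intro Henstock_Kurzweil_Integration.integral_combine inventory_integrable P[OF i]) (auto intro: less_imp_le)
      have "window_cost W i (P i) (s j) (s (Suc j))
        \<le> order_cost W i * ((1 + 1 / real m) * (real ?b - real ?a)) + 2 * hold_cost W i * ((1 + 1 / real m) * ?I)"
        unfolding window_cost_def using n I1 KH[OF i] by (intro add_mono mult_left_mono) auto
      also have "\<dots> = (1 + 1 / real m) * (order_cost W i * (real ?b - real ?a) + 2 * hold_cost W i * ?I)"
        by (simp add: algebra_simps)
      finally show ?thesis using split[symmetric] by (simp add: algebra_simps)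
    qed
    then show ?thesis
      unfolding F_def sum_subtractf[symmetric] sum_distrib_left by (rule sum_mono)
  qed
  \<comment> \<open>By the assumed contrary every window is too expensive; the common factor
    \<open>1 + 1 / m\<close> cancels.\<close>
  have "B * (s (Suc j) - s j) < F (Suc j) - F j" for j
  proof -
    have "(1 + 1 / real m) * B * (s (Suc j) - s j) < (\<Sum>i\<in>?C. window_cost W i (P i) (s j) (s (Suc j)))"
      using contr step[of j] s_nonneg[of j] by (meson not_le)
    also note window_le[of j]
    finally have "(1 + 1 / real m) * (B * (s (Suc j) - s j)) < (1 + 1 / real m) * (F (Suc j) - F j)"
      by (simp only: mult.assoc)
    then show ?thesis using m by (simp add: mult_less_cancel_left_pos add_pos_pos)
  qed
  then have "(\<Sum>j<J. B * (s (Suc j) - s j)) \<le> (\<Sum>j<J. F (Suc j) - F j)" for J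
    by (intro sum_mono less_imp_le)
  then have low: "B * s J \<le> F J - F 0" for J
    by (simp add: sum_distrib_left[symmetric] sum_lessThan_telescope s_0)
  \<comment> \<open>\<open>F J\<close> may contain an order at \<open>s J\<close>, which
    \<open>cost_upto\<close> leaves out; subtracting the order at time 0 in \<open>F 0\<close> makes
    up for it.\<close>
  have high: "F J - F 0 \<le> (\<Sum>i\<in>?C. cost_upto W i (P i) (s J))" for J
    unfolding F_def sum_subtractf[symmetric]
  proof (rule sum_mono)
    fix i assume i: "i \<in> ?C"
    have "real (orders_upto (P i) (s J)) - 1 \<le> real (num_orders (P i) {0..<s J})"
      using orders_upto_le_num_orders[OF P[OF i] s_nonneg[of J]] by linarith
    then have "order_cost W i * (real (orders_upto (P i) (s J)) - 1) \<le> order_cost W i * real (num_orders (P i) {0..<s J})"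
      using KH[OF i] by (intro mult_left_mono) auto
    then show "order_cost W i * real (orders_upto (P i) (s J)) + 2 * hold_cost W i * integral {0..s J} (inventory (P i))
      - (order_cost W i * real (orders_upto (P i) (s 0)) + 2 * hold_cost W i * integral {0..s 0} (inventory (P i)))
      \<le> cost_upto W i (P i) (s J)"
      unfolding cost_upto_def s_0 orders_upto_0[OF P[OF i]] by (simp add: algebra_simps)
  qed
  have "eventually (\<lambda>t. 0 < t \<and> (\<Sum>i\<in>?C. cost_upto W i (P i) t / t) < B) at_top"
    using eventually_gt_at_top[of "0::real"] total_cost_eventually_less[of W P B, OF W P B]
    by (intro eventually_conj)
  then obtain T where T: "\<And>t. T \<le> t \<Longrightarrow> 0 < t \<and> (\<Sum>i\<in>?C. cost_upto W i (P i) t / t) < B"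
    unfolding eventually_at_top_linorder by blast
  obtain i where i: "i \<in> ?C" using ne by blast
  obtain J where "T \<le> order_time (P i) J"
    using P[OF i] unfolding valid_policy_def filterlim_at_top eventually_sequentially by blast
  also have "\<dots> \<le> s J" using order_time_le_iff[OF P[OF i] s_nonneg] upto_ge[OF i] by blast
  finally have "0 < s J" "(\<Sum>i\<in>?C. cost_upto W i (P i) (s J)) / s J < B"
    using T by (auto simp: sum_divide_distrib)
  then have "(\<Sum>i\<in>?C. cost_upto W i (P i) (s J)) < B * s J" by (simp add: divide_less_eq)
  then show False using low[of J] high[of J] by linarith
qed

section \<open>Repeating a cheap window for all commodities\<close>

text \<open>A cheap window of length \<open>\<tau>\<close> costs at most \<open>c * \<tau>\<close>
  in total, and this bounds the ordering and the holding cost of each single commodity in it. With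
  \<open>N\<close> orders the holding cost is at least
  \<open>hold_cost W i * (\<tau> / N)\<^sup>2\<close> by the longest gap, whence the last
  inequality.\<close>

lemma cyclic_approximation:
  assumes W: "valid_warehouse W" and P: "capacity_feasible W P"
    and B: "total_cost W P < ereal B" and m: "0 < m"
  defines "c \<equiv> (1 + 1 / real m) * B"
  shows "\<exists>Q \<tau>. capacity_feasible W Q \<and> cyclic_policy W \<tau> Q \<and> total_cost W Q \<le> ereal c \<and>
    (\<forall>i\<in>commodities W. m \<le> num_orders (Q i) {0..<\<tau>} \<and>
       order_cost W i * real (num_orders (Q i) {0..<\<tau>}) \<le> c * \<tau> \<and>
       hold_cost W i * \<tau> \<le> c * (real (num_orders (Q i) {0..<\<tau>}))\<^sup>2) \<and>
    (\<exists>i\<in>commodities W. num_orders (Q i) {0..<\<tau>} = m)"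
proof -
  let ?C = "commodities W"
  have fin: "finite ?C" by (simp add: commodities_def)
  have W_pos: "0 < order_cost W i" "0 < hold_cost W i" "0 < space_req W i" if "i \<in> ?C" for i
    using W that by (auto simp: valid_warehouse_def)
  have valid: "valid_policy (P i)" if "i \<in> ?C" for i
    using P that by (simp add: capacity_feasible_def)
  obtain a b where ab: "0 \<le> a" "a < b"
    and N_ge: "\<And>i. i \<in> ?C \<Longrightarrow> m \<le> window_orders (P i) a b"
    and N_eq: "\<exists>i\<in>?C. window_orders (P i) a b = m"
    and cost: "(\<Sum>i\<in>?C. window_cost W i (P i) a b) \<le> c * (b - a)"
    using ex_cheap_window[of W P B m, OF W valid B m] unfolding c_def by blast
  define \<tau> where "\<tau> = b - a"
  have \<tau>: "0 < \<tau>" using ab by (simp add: \<tau>_def)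
  define R where "R i q \<longleftrightarrow> valid_policy q \<and>
    (\<forall>j. \<forall>s\<in>{0..<\<tau>}. \<forall>y. order_at q (real j * \<tau> + s) y \<longleftrightarrow> order_at q s y) \<and>
    num_orders q {0..<\<tau>} = window_orders (P i) a b \<and>
    (\<forall>j. \<forall>s\<in>{0..<\<tau>}. inventory q (real j * \<tau> + s) \<le> inventory (P i) (a + s)) \<and>
    avg_cost W i q \<le> ereal (window_cost W i (P i) a b / \<tau>)" for i q
  have "\<forall>i\<in>?C. \<exists>q. R i q"
    unfolding R_def \<tau>_def window_cost_def window_orders_def
    by (intro ballI cyclic_policy_from_window ab) (auto intro: valid less_imp_le W_pos)
  then obtain Q where Q: "\<forall>i\<in>?C. R i (Q i)" using bchoice[of ?C R] by blast
  have Q_valid: "valid_policy (Q i)"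
    and Q_cyc: "s \<in> {0..<\<tau>} \<Longrightarrow> order_at (Q i) (real j * \<tau> + s) y \<longleftrightarrow> order_at (Q i) s y"
    and Q_num: "num_orders (Q i) {0..<\<tau>} = window_orders (P i) a b"
    and Q_inv: "s \<in> {0..<\<tau>} \<Longrightarrow> inventory (Q i) (real j * \<tau> + s) \<le> inventory (P i) (a + s)"
    and Q_cost: "avg_cost W i (Q i) \<le> ereal (window_cost W i (P i) a b / \<tau>)"
    if "i \<in> ?C" for i j s y
    using Q that unfolding R_def by auto
  have "capacity_feasible W Q"
    unfolding capacity_feasible_def V_max_def
  proof (intro conjI ballI SUP_least)
    fix t :: real assume "t \<in> {0..}"
    then obtain j s where js: "t = real j * \<tau> + s" "s \<in> {0..<\<tau>}"
      using period_decomp[OF \<tau>, of t] by auto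
    \<comment> \<open>The window is common to all commodities, so all inventories at
      \<open>t\<close> are compared with \<open>P\<close> at the same time \<open>a + s\<close>,
      where the capacity suffices.\<close>
    have "(\<Sum>i\<in>?C. space_req W i * inventory (Q i) t) \<le> (\<Sum>i\<in>?C. space_req W i * inventory (P i) (a + s))"
      using W_pos Q_inv js by (intro sum_mono mult_left_mono) (auto intro: less_imp_le)
    moreover have "ereal (\<Sum>i\<in>?C. space_req W i * inventory (P i) (a + s)) \<le> V_max W P"
      unfolding V_max_def by (rule SUP_upper) (use js ab in auto)
    moreover have "V_max W P \<le> ereal (capacity W)" using P by (simp add: capacity_feasible_def)
    ultimately show "ereal (\<Sum>i\<in>?C. space_req W i * inventory (Q i) t) \<le> ereal (capacity W)"
      by (meson ereal_less_eq(3) order_trans)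
  qed (rule Q_valid)
  moreover have "cyclic_policy W \<tau> Q"
    using \<tau> Q_cyc by (simp add: cyclic_policy_def)
  moreover have "total_cost W Q \<le> ereal c"
  proof -
    have "total_cost W Q \<le> (\<Sum>i\<in>?C. ereal (window_cost W i (P i) a b / \<tau>))"
      unfolding total_cost_def by (rule sum_mono) (rule Q_cost)
    also have "\<dots> = ereal ((\<Sum>i\<in>?C. window_cost W i (P i) a b) / \<tau>)"
      by (simp add: sum_divide_distrib)
    also have "\<dots> \<le> ereal c" using cost \<tau> by (simp add: \<tau>_def divide_le_eq)
    finally show ?thesis .
  qed
  moreover have "order_cost W i * real (num_orders (Q i) {0..<\<tau>}) \<le> c * \<tau> \<and>
       hold_cost W i * \<tau> \<le> c * (real (num_orders (Q i) {0..<\<tau>}))\<^sup>2" if i: "i \<in> ?C" for i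
  proof -
    let ?N = "real (window_orders (P i) a b)" and ?I = "\<lambda>i. integral {a..b} (inventory (P i))"
    have I: "0 \<le> ?I j" if "j \<in> ?C" for j
      by (rule integral_inventory_nonneg[OF valid[OF that] ab(1)])
    then have nonneg: "0 \<le> window_cost W j (P j) a b" if "j \<in> ?C" for j
      using W_pos[OF that] that by (simp add: window_cost_def)
    have le: "window_cost W i (P i) a b \<le> c * \<tau>"
      using member_le_sum[of i ?C "\<lambda>i. window_cost W i (P i) a b"] i fin nonneg cost
      by (force simp: \<tau>_def)
    have K: "order_cost W i * ?N \<le> c * \<tau>"
      using le I[OF i] W_pos[OF i] unfolding window_cost_def
      by (smt (verit) mult_nonneg_nonneg)
    have N: "0 < ?N" by (simp add: window_orders_def)
    have "hold_cost W i * (\<tau> / ?N)\<^sup>2 = 2 * hold_cost W i * ((\<tau> / ?N)\<^sup>2 / 2)" by simp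
    also have "\<dots> \<le> 2 * hold_cost W i * ?I i"
      using integral_inventory_window_ge[OF valid[OF i] ab] W_pos[OF i]
      unfolding window_orders_def \<tau>_def by (intro mult_left_mono) auto
    also have "\<dots> \<le> window_cost W i (P i) a b"
      using W_pos[OF i] by (simp add: window_cost_def)
    also note le
    finally have "\<tau> * (hold_cost W i * \<tau>) \<le> \<tau> * (c * ?N\<^sup>2)"
      using N by (simp add: power_divide field_simps power2_eq_square)
    then have "hold_cost W i * \<tau> \<le> c * ?N\<^sup>2" using \<tau> by simp
    then show ?thesis using K Q_num[OF i] by simp
  qed
  ultimately show ?thesis
    using N_ge N_eq Q_num by (intro exI[of _ Q] exI[of _ \<tau>]) auto
qed

section \<open>Upper and lower bounds on the optimal value\<close>

text \<open>A cycle with one order of quantity \<open>T\<close>: the inventory falls from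
  \<open>T\<close> to 0 with area \<open>T\<^sup>2 / 2\<close> per cycle, and the factor 2 in the
  holding cost cancels.\<close>

lemma equal_interval_policy:
  assumes T: "0 < T"
  obtains q where "valid_policy q" "\<And>t. 0 \<le> t \<Longrightarrow> inventory q t \<le> T"
    "\<And>W i. 0 \<le> order_cost W i \<Longrightarrow> 0 \<le> hold_cost W i \<Longrightarrow>
       avg_cost W i q \<le> ereal (order_cost W i / T + hold_cost W i * T)"
proof -
  interpret order_cycle 1 "\<lambda>r. real r * T" "\<lambda>_. T" T
    by unfold_locales (use T in auto)
  have inv: "inventory repeated (real j * T + s) = T - s" if "s \<in> {0..<T}" for j s
    using inventory_repeated[of 0 s j] that by simp
  have "inventory repeated t \<le> T" if "0 \<le> t" for t
    using period_decomp[OF T that] inv by (metis atLeastLessThan_iff diff_le_eq le_add_same_cancel1)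
  moreover have "avg_cost W i repeated \<le> ereal (order_cost W i / T + hold_cost W i * T)"
    if "0 \<le> order_cost W i" "0 \<le> hold_cost W i" for W i
  proof -
    have "((\<lambda>t. T - t) has_integral T\<^sup>2 / 2) {0..T}"
      using has_integral_diff[OF has_integral_const_real[of T 0 T] ident_has_integral[of 0 T]] T
      by (simp add: power2_eq_square)
    then have "(inventory repeated has_integral T\<^sup>2 / 2) {0..T}"
      by (rule has_integral_spike_finite[rotated 2, of _ _ _ "{T}"]) (use inv[of _ 0] in auto)
    then have "integral {0..T} (inventory repeated) = T\<^sup>2 / 2" by (rule integral_unique)
    moreover have "(order_cost W i * real 1 + 2 * hold_cost W i * (T\<^sup>2 / 2)) / T = order_cost W i / T + hold_cost W i * T"
      using T by (simp add: power2_eq_square add_divide_distrib)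
    ultimately show ?thesis using avg_cost_repeated_le[OF that] by metis
  qed
  ultimately show ?thesis using that valid_repeated by blast
qed

text \<open>With intervals \<open>T_cap W i / n\<close> each commodity occupies at most the share
  \<open>capacity W / n\<close>, so the policy is feasible even when all peaks coincide. Ordering
  costs grow by the factor \<open>n\<close>, and holding costs only shrink.\<close>

lemma OPT_le:
  assumes W: "valid_warehouse W"
  shows "OPT W \<le> ereal (real (num_comm W) * M_bound W)"
proof -
  let ?C = "commodities W" and ?n = "real (num_comm W)"
  have n: "1 \<le> ?n" and cap: "0 < capacity W" using W by (auto simp: valid_warehouse_def)
  have W_pos: "0 < order_cost W i" "0 < hold_cost W i" "0 < space_req W i" if "i \<in> ?C" for i
    using W that by (auto simp: valid_warehouse_def)
  have T_pos: "0 < T_cap W i" if "i \<in> ?C" for i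
    using W_pos[OF that] cap by (simp add: T_cap_def)
  define T where "T i = T_cap W i / ?n" for i
  have "\<exists>q. valid_policy q \<and> (\<forall>t\<ge>0. inventory q t \<le> T i) \<and>
     avg_cost W i q \<le> ereal (order_cost W i / T i + hold_cost W i * T i)" if i: "i \<in> ?C" for i
  proof -
    have "0 < T i" using T_pos[OF i] n by (simp add: T_def)
    from equal_interval_policy[OF this] show ?thesis
      using W_pos[OF i] by (metis less_imp_le)
  qed
  then obtain P where P: "\<And>i. i \<in> ?C \<Longrightarrow> valid_policy (P i)"
    "\<And>i t. i \<in> ?C \<Longrightarrow> 0 \<le> t \<Longrightarrow> inventory (P i) t \<le> T i"
    "\<And>i. i \<in> ?C \<Longrightarrow> avg_cost W i (P i) \<le> ereal (order_cost W i / T i + hold_cost W i * T i)"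
    by metis
  have "capacity_feasible W P"
    unfolding capacity_feasible_def V_max_def
  proof (intro conjI ballI SUP_least)
    fix t :: real assume t: "t \<in> {0..}"
    have "(\<Sum>i\<in>?C. space_req W i * inventory (P i) t) \<le> (\<Sum>i\<in>?C. capacity W / ?n)"
    proof (rule sum_mono)
      fix i assume i: "i \<in> ?C"
      have "space_req W i * inventory (P i) t \<le> space_req W i * T i"
        using P(2)[OF i] t W_pos[OF i] by (intro mult_left_mono) auto
      also have "\<dots> \<le> space_req W i * (capacity W / space_req W i / ?n)"
        unfolding T_def T_cap_def using W_pos[OF i] n
        by (intro mult_left_mono divide_right_mono) auto
      also have "\<dots> = capacity W / ?n" using W_pos[OF i] by simp
      finally show "space_req W i * inventory (P i) t \<le> capacity W / ?n" .
    qed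
    also have "\<dots> = capacity W" using n by (simp add: commodities_def)
    finally show "ereal (\<Sum>i\<in>?C. space_req W i * inventory (P i) t) \<le> ereal (capacity W)" by simp
  qed (rule P(1))
  then have "OPT W \<le> total_cost W P" unfolding OPT_def by (intro INF_lower) simp
  also have "\<dots> \<le> (\<Sum>i\<in>?C. ereal (order_cost W i / T i + hold_cost W i * T i))"
    unfolding total_cost_def by (rule sum_mono) (rule P(3))
  also have "\<dots> \<le> ereal (?n * M_bound W)"
    unfolding sum_ereal M_bound_def sum_distrib_left ereal_less_eq(3)
  proof (rule sum_mono)
    fix i assume i: "i \<in> ?C"
    have "hold_cost W i * T_cap W i / ?n \<le> ?n * (hold_cost W i * T_cap W i)"
    proof -
      have "hold_cost W i * T_cap W i * 1 \<le> hold_cost W i * T_cap W i * (?n * ?n)"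
        using n T_pos[OF i] W_pos[OF i] mult_mono[of 1 ?n 1 ?n] by (intro mult_left_mono) auto
      then show ?thesis using n by (simp add: divide_le_eq mult_ac)
    qed
    then show "order_cost W i / T i + hold_cost W i * T i
      \<le> ?n * (order_cost W i / T_cap W i + hold_cost W i * T_cap W i)"
      by (simp add: T_def algebra_simps)
  qed
  finally show ?thesis .
qed

text \<open>Let \<kappa> be the least of all ordering and holding parameters. A cost below
  \<open>B < \<kappa> / 2\<close> would yield, for \<open>m = 1\<close>, a cyclic policy in which
  some commodity orders once per cycle. Its ordering cost forces \<open>\<tau> > 1\<close> and its
  holding cost \<open>\<tau> < 1\<close>.\<close>

lemma OPT_pos:
  assumes W: "valid_warehouse W"
  shows "0 < OPT W"
proof -
  let ?C = "commodities W"
  have fin: "finite ?C" and ne: "?C \<noteq> {}" using W by (auto simp: commodities_def valid_warehouse_def)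
  define \<kappa> where "\<kappa> = Min ((\<lambda>i. min (order_cost W i) (hold_cost W i)) ` ?C)"
  have \<kappa>_le: "\<kappa> \<le> order_cost W i" "\<kappa> \<le> hold_cost W i" if "i \<in> ?C" for i
    using Min_le[of "(\<lambda>i. min (order_cost W i) (hold_cost W i)) ` ?C"] fin that
    unfolding \<kappa>_def by (meson finite_imageI imageI min.bounded_iff)+
  have \<kappa>_pos: "0 < \<kappa>"
    unfolding \<kappa>_def using fin ne W by (subst Min_gr_iff) (auto simp: valid_warehouse_def)
  have "ereal (\<kappa> / 2) \<le> total_cost W P" if P: "capacity_feasible W P" for P
  proof (rule ccontr)
    assume "\<not> ?thesis"
    then have "total_cost W P < ereal (\<kappa> / 2)" by simp
    then obtain B where B: "total_cost W P < ereal B" "B < \<kappa> / 2"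
      using ereal_dense2 by fastforce
    obtain Q \<tau> i where Q: "cyclic_policy W \<tau> Q" "i \<in> ?C" "num_orders (Q i) {0..<\<tau>} = 1"
      "order_cost W i \<le> 2 * B * \<tau>" "hold_cost W i * \<tau> \<le> 2 * B"
      using cyclic_approximation[OF W P B(1), of 1] by fastforce
    have \<tau>: "0 < \<tau>" using Q by (simp add: cyclic_policy_def)
    have "\<kappa> \<le> 2 * B * \<tau>" using Q \<kappa>_le by force
    also have "\<dots> < \<kappa> * \<tau>" using B \<tau> by simp
    finally have "1 < \<tau>" using \<kappa>_pos by simp
    then have "\<kappa> * 1 < \<kappa> * \<tau>" using \<kappa>_pos by (intro mult_strict_left_mono)
    also have "\<dots> \<le> hold_cost W i * \<tau>" using Q \<kappa>_le \<tau> by (intro mult_right_mono) auto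
    finally show False using Q B by simp
  qed
  then have "ereal (\<kappa> / 2) \<le> OPT W" unfolding OPT_def by (intro INF_greatest) simp
  then show ?thesis using \<kappa>_pos by (metis ereal_less(2) half_gt_zero order_less_le_trans)
qed

section \<open>Choice of the constants and the final bounds\<close>

theorem theorem2:
  fixes \<epsilon> :: real and W :: warehouse
  assumes "0 < \<epsilon>" and "\<epsilon> < 1 / 3" and "1 / \<epsilon> \<in> \<int>"
    and "valid_warehouse W"
  shows "\<exists>(P :: nat \<Rightarrow> policy) (\<tau> :: real).
    capacity_feasible W P \<and> cyclic_policy W \<tau> P \<and>
    total_cost W P \<le> ereal (1 + 3 * \<epsilon>) * OPT W \<and>
    \<tau> \<in> {K_max W / (2 * \<epsilon> * real (num_comm W) * M_bound W) ..
          2 * real (num_comm W) * M_bound W / (\<epsilon>\<^sup>2 * H_min W)} \<and>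
    (\<forall>i\<in>commodities W.
       real (num_orders (P i) {0..<\<tau>}) \<in>
         {1 / \<epsilon> ..
          4 * (real (num_comm W))\<^sup>2 * (M_bound W)\<^sup>2 / (\<epsilon>\<^sup>2 * K_min W * H_min W)}) \<and>
    (\<exists>i\<in>commodities W. real (num_orders (P i) {0..<\<tau>}) = 1 / \<epsilon>)"
proof -
  note \<epsilon> = assms(1,2) and W = assms(4)
  let ?C = "commodities W"
  have fin: "finite ?C" and ne: "?C \<noteq> {}" using W by (auto simp: commodities_def valid_warehouse_def)
  have W_pos: "0 < order_cost W i" "0 < hold_cost W i" if "i \<in> ?C" for i
    using W that by (auto simp: valid_warehouse_def)
  obtain z where z: "1 / \<epsilon> = of_int z" using assms(3) by (auto elim: Ints_cases)
  define m where "m = nat z"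
  have "0 < z" using z \<epsilon> by (metis of_int_0_less_iff zero_less_divide_1_iff)
  then have m: "0 < m" "real m = 1 / \<epsilon>" using z by (auto simp: m_def)
  then have m_inv: "1 / real m = \<epsilon>" by simp
  obtain v where v: "OPT W = ereal v" "0 < v" "v \<le> real (num_comm W) * M_bound W"
    using OPT_pos[OF W] OPT_le[OF W] by (cases "OPT W") auto
  \<comment> \<open>Dominates \<open>2 * OPT W\<close>, hence also \<open>c\<close>, because
    \<open>1 + 3 * \<epsilon> \<le> 2\<close>.\<close>
  define D where "D = 2 * real (num_comm W) * M_bound W"
  \<comment> \<open>Chosen so that the loss factor \<open>1 + 1 / m = 1 + \<epsilon>\<close> leads
    exactly to \<open>(1 + 3 * \<epsilon>) * v\<close>. As \<open>B > v\<close> by positivity of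
    \<open>v\<close>, some feasible policy costs less than \<open>B\<close>.\<close>
  define B where "B = (1 + 3 * \<epsilon>) / (1 + \<epsilon>) * v"
  define c where "c = (1 + 3 * \<epsilon>) * v"
  have c: "(1 + 1 / real m) * B = c" using \<epsilon> by (simp add: m_inv B_def c_def)
  have "(1 + 3 * \<epsilon>) * v \<le> 2 * v" using \<epsilon> v by (intro mult_right_mono) auto
  also have "\<dots> \<le> D" using v by (simp add: D_def mult.assoc)
  finally have cD: "c \<le> D" by (simp add: c_def)
  have c_pos: "0 < c" using \<epsilon> v by (simp add: c_def)
  then have D: "0 < D" using cD by simp
  have "1 < (1 + 3 * \<epsilon>) / (1 + \<epsilon>)" using \<epsilon> by simp
  then have "1 * v < B" unfolding B_def using v by (intro mult_strict_right_mono)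
  then have "OPT W < ereal B" using v by simp
  then obtain P where P: "capacity_feasible W P" "total_cost W P < ereal B"
    unfolding OPT_def INF_less_iff by auto
  obtain Q \<tau> where Q: "capacity_feasible W Q" "cyclic_policy W \<tau> Q" "total_cost W Q \<le> ereal c"
    and N_ge: "\<And>i. i \<in> ?C \<Longrightarrow> m \<le> num_orders (Q i) {0..<\<tau>}"
    and K_le: "\<And>i. i \<in> ?C \<Longrightarrow> order_cost W i * real (num_orders (Q i) {0..<\<tau>}) \<le> c * \<tau>"
    and H_le: "\<And>i. i \<in> ?C \<Longrightarrow> hold_cost W i * \<tau> \<le> c * (real (num_orders (Q i) {0..<\<tau>}))\<^sup>2"
    and N_eq: "\<exists>i\<in>?C. num_orders (Q i) {0..<\<tau>} = m"
    using cyclic_approximation[OF W P m(1)] unfolding c by blast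
  have \<tau>: "0 < \<tau>" using Q by (simp add: cyclic_policy_def)
  have "K_max W \<in> order_cost W ` ?C" unfolding K_max_def using fin ne by (intro Max_in) auto
  then obtain k where k: "k \<in> ?C" "K_max W = order_cost W k" by blast
  have H_min: "0 < H_min W" "\<And>i. i \<in> ?C \<Longrightarrow> H_min W \<le> hold_cost W i"
    unfolding H_min_def using fin ne W_pos by auto
  have K_min: "0 < K_min W" "\<And>i. i \<in> ?C \<Longrightarrow> K_min W \<le> order_cost W i"
    unfolding K_min_def using fin ne W_pos by auto
  have cD\<tau>: "c * \<tau> \<le> D * \<tau>" using cD \<tau> by simp
  \<comment> \<open>The commodity with the largest ordering cost places at least
    \<open>1 / \<epsilon>\<close> orders, so the cycle cannot be short.\<close>
  have "order_cost W k * (1 / \<epsilon>) \<le> order_cost W k * real (num_orders (Q k) {0..<\<tau>})"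
    unfolding m(2)[symmetric] using W_pos[OF k(1)] N_ge[OF k(1)] by (intro mult_left_mono) auto
  then have "K_max W / \<epsilon> \<le> D * \<tau>" using K_le[OF k(1)] cD\<tau> k(2) by simp
  then have lower: "K_max W / (\<epsilon> * D) \<le> \<tau>" using \<epsilon> D by (simp add: field_simps)
  \<comment> \<open>The commodity with exactly \<open>1 / \<epsilon>\<close> orders would hold too
    much stock in a long cycle.\<close>
  obtain l where l: "l \<in> ?C" "num_orders (Q l) {0..<\<tau>} = m" using N_eq by blast
  have "H_min W * \<tau> \<le> hold_cost W l * \<tau>" using H_min l \<tau> by (intro mult_right_mono) auto
  also have "\<dots> \<le> c * (1 / \<epsilon>)\<^sup>2" using H_le[OF l(1)] l(2) m(2) by simp
  also have "\<dots> \<le> D * (1 / \<epsilon>)\<^sup>2" using cD by (intro mult_right_mono) auto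
  finally have upper: "\<tau> \<le> D / (\<epsilon>\<^sup>2 * H_min W)"
    using \<epsilon> H_min by (simp add: field_simps power_divide)
  \<comment> \<open>The ordering cost bounds the number of orders by
    \<open>D * \<tau> / K_min W\<close>; the upper bound on \<open>\<tau>\<close> supplies the
    second factor \<open>D\<close>.\<close>
  have "real (num_orders (Q i) {0..<\<tau>}) \<le> D\<^sup>2 / (\<epsilon>\<^sup>2 * K_min W * H_min W)" if i: "i \<in> ?C" for i
  proof -
    have "K_min W * real (num_orders (Q i) {0..<\<tau>}) \<le> order_cost W i * real (num_orders (Q i) {0..<\<tau>})"
      using K_min i by (intro mult_right_mono) auto
    also have "\<dots> \<le> D * \<tau>" using K_le[OF i] cD\<tau> by simp
    also have "\<dots> \<le> D * (D / (\<epsilon>\<^sup>2 * H_min W))" using upper D by (intro mult_left_mono) auto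
    finally show ?thesis using K_min H_min \<epsilon> by (simp add: field_simps power2_eq_square)
  qed
  then have num_le: "real (num_orders (Q i) {0..<\<tau>})
      \<le> 4 * (real (num_comm W))\<^sup>2 * (M_bound W)\<^sup>2 / (\<epsilon>\<^sup>2 * K_min W * H_min W)" if "i \<in> ?C" for i
    using that by (simp add: D_def power_mult_distrib)
  have "1 / \<epsilon> \<le> real (num_orders (Q i) {0..<\<tau>})" if "i \<in> ?C" for i
    unfolding m(2)[symmetric] using N_ge[OF that] by simp
  moreover have "total_cost W Q \<le> ereal (1 + 3 * \<epsilon>) * OPT W"
    using Q(3) v by (simp add: c_def)
  moreover have "\<exists>i\<in>?C. real (num_orders (Q i) {0..<\<tau>}) = 1 / \<epsilon>"
    using l m(2) by auto
  moreover have "K_max W / (2 * \<epsilon> * real (num_comm W) * M_bound W) \<le> \<tau>"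
    using lower by (simp add: D_def mult_ac)
  moreover have "\<tau> \<le> 2 * real (num_comm W) * M_bound W / (\<epsilon>\<^sup>2 * H_min W)"
    using upper by (simp add: D_def)
  ultimately show ?thesis using Q(1,2) num_le by (intro exI[of _ Q] exI[of _ \<tau>]) auto
qed

end
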